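(* Let $Z^H\in\mathfrak h$ and let $\Lambda_1(z),\dots,\Lambda_r(z)$ be monic polynomials. Consider the $qq$-system $$W(q^i_+,q^i_-)(z)+\langle\alpha_i,Z^H\rangle q^i_+(z)q^i_-(z)=\Lambda_i(z)\prod_{j\ne i}\big[q^j_+(z)\big]^{-a_{ji}},\qquad i=1,\dots,r,$$ and the Bethe Ansatz equations $$\langle\alpha_i,Z^H\rangle+\partial_z\log\Big[\Lambda_i(z)\prod_{j}q^j_+(z)^{-a_{ji}}(z-w^i_\ell)^2\Big]\Big|_{z=w^i_\ell}=0,\qquad i=1,\dots,r,\ \ \ell=1,\dots,\deg q^i_+,$$ where $q^i_+(z)=\prod_\ell(z-w^i_\ell)$. 1. If $\langle\alpha_i,Z^H\rangle\neq0$ for all $i$ (for example, if $Z^H$ is regular semisimple), then there is a bijection between the solutions of the Bethe Ansatz equations and the nondegenerate polynomial solutions of the $qq$-system (taking $q^i_+(z)=\prod_\ell(z-w^i_\ell)$). 2. If $\langle\alpha_l,Z^H\rangle=0$ for $l=i_1,\dots,i_k$ and is nonzero otherwise, then $\{q^i_+(z)\}_{i=1,\dots,r}$ and $\{q^i_-(z)\}_{i\ne i_1,\dots,i_k}$ are uniquely determined by the (solution of the) Bethe Ansatz equations, but each $q^{i_j}_-(z)$, $j=1,\dots,k$, is only determined up to an arbitrary transformation $q^{i_j}_-(z)\mapsto q^{i_j}_-(z)+c_jq^{i_j}_+(z)$ with $c_j\in\mathbb C$.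
   Context: Let $\mathfrak g$ be a simple complex Lie algebra of rank $r$ with Cartan subalgebra $\mathfrak h$, simple roots $\alpha_1,\dots,\alpha_r$, simple coroots $\check\alpha_1,\dots,\check\alpha_r$, and Cartan matrix $a_{ij}=\langle\alpha_j,\check\alpha_i\rangle$. The Wronskian is $W(q_+,q_-)=q_+\partial_zq_--q_-\partial_zq_+$. A polynomial solution $\{q^i_+,q^i_-\}_{i=1,\dots,r}$ of the $qq$-system is nondegenerate if each $q^i_+$ is monic and: (a) no $q^i_+$ has a multiple root; (b) for each $i$, $q^i_+$ and $\Lambda_i$ have no common root; (c) if $i\neq j$ and $a_{ij}\ne0$, then $q^i_+$ and $q^j_+$ have no common root. A solution of the Bethe Ansatz equations is a family of finite unordered collections $\{w^i_\ell\}_{\ell}$ of complex numbers, $i=1,\dots,r$ (equivalently, a family of monic polynomials $q^i_+(z)=\prod_\ell(z-w^i_\ell)$), for which the equations make sense, i.e. $w^i_\ell$ is not a root of $\Lambda_i$ and $w^i_\ell\neq w^j_s$ whenever $a_{ji}\neq0$ and $(i,\ell)\neq(j,s)$, and for which the equations hold. *)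

theory Defs
  imports "HOL-Complex_Analysis.Complex_Analysis"
begin

section \<open>Simple complex Lie algebras with a base of simple roots\<close>

locale complex_lie_algebra = vector_space scale
  for scale :: "complex \<Rightarrow> 'g::ab_group_add \<Rightarrow> 'g" +
  fixes br :: "'g \<Rightarrow> 'g \<Rightarrow> 'g"
  assumes finite_dim: "\<exists>B. finite B \<and> span B = UNIV"
    and br_add_left: "br (x + y) z = br x z + br y z"
    and br_add_right: "br x (y + z) = br x y + br x z"
    and br_scale_left: "br (scale c x) y = scale c (br x y)"
    and br_scale_right: "br x (scale c y) = scale c (br x y)"
    and br_self: "br x x = 0"
    and jacobi: "br x (br y z) + br y (br z x) + br z (br x y) = 0"
begin

definition lie_ideal :: "'g set \<Rightarrow> bool" where
  "lie_ideal I \<longleftrightarrow> subspace I \<and> (\<forall>x. \<forall>y\<in>I. br x y \<in> I)"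

definition ad_diagonalizable :: "'g \<Rightarrow> bool" where
  "ad_diagonalizable H \<longleftrightarrow> span {x. \<exists>c. br H x = scale c x} = UNIV"

definition centralizer :: "'g \<Rightarrow> 'g set" where
  "centralizer x = {y. br x y = 0}"

text \<open>
  Cartan subalgebras in the form usual for complex semisimple Lie algebras (as in
  Hall's textbook): maximal commutative, consisting of ad-diagonalizable elements.
\<close>

definition cartan_subalgebra :: "'g set \<Rightarrow> bool" where
  "cartan_subalgebra h \<longleftrightarrow>
     subspace h \<and>
     (\<forall>H\<in>h. \<forall>H'\<in>h. br H H' = 0) \<and>
     (\<forall>x. (\<forall>H\<in>h. br H x = 0) \<longrightarrow> x \<in> h) \<and>
     (\<forall>H\<in>h. ad_diagonalizable H)"

definition regular_semisimple :: "'g \<Rightarrow> bool" where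
  "regular_semisimple x \<longleftrightarrow> ad_diagonalizable x \<and> cartan_subalgebra (centralizer x)"

text \<open>
  Elements of the dual of \<open>h\<close> are functions on the whole Lie algebra
  of which only the values on \<open>h\<close> matter.
\<close>

definition functional_on :: "'g set \<Rightarrow> ('g \<Rightarrow> complex) \<Rightarrow> bool" where
  "functional_on h \<beta> \<longleftrightarrow>
     (\<forall>H\<in>h. \<forall>H'\<in>h. \<beta> (H + H') = \<beta> H + \<beta> H') \<and>
     (\<forall>c. \<forall>H\<in>h. \<beta> (scale c H) = c * \<beta> H)"

definition root_space :: "'g set \<Rightarrow> ('g \<Rightarrow> complex) \<Rightarrow> 'g set" where
  "root_space h \<beta> = {x. \<forall>H\<in>h. br H x = scale (\<beta> H) x}"

definition is_root :: "'g set \<Rightarrow> ('g \<Rightarrow> complex) \<Rightarrow> bool" where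
  "is_root h \<beta> \<longleftrightarrow>
     functional_on h \<beta> \<and> (\<exists>H\<in>h. \<beta> H \<noteq> 0) \<and> root_space h \<beta> \<noteq> {0}"

text \<open>
  The coroot of \<open>\<beta>\<close> is the unique element of
  \<open>[root_space h \<beta>, root_space h (-\<beta>)]\<close> on which \<open>\<beta>\<close> takes the value 2.
  In the semisimple case that space is a line, so each of its elements is a
  single bracket.
\<close>

definition is_coroot :: "'g set \<Rightarrow> ('g \<Rightarrow> complex) \<Rightarrow> 'g \<Rightarrow> bool" where
  "is_coroot h \<beta> c \<longleftrightarrow>
     c \<in> h \<and> \<beta> c = 2 \<and>
     (\<exists>e\<in>root_space h \<beta>. \<exists>f\<in>root_space h (\<lambda>H. - \<beta> H). br e f = c)"

definition is_base :: "'g set \<Rightarrow> ('i::finite \<Rightarrow> 'g \<Rightarrow> complex) \<Rightarrow> bool" where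
  "is_base h \<alpha> \<longleftrightarrow>
     (\<forall>i. is_root h (\<alpha> i)) \<and>
     (\<forall>c :: 'i \<Rightarrow> complex. (\<forall>H\<in>h. (\<Sum>i\<in>UNIV. c i * \<alpha> i H) = 0) \<longrightarrow> (\<forall>i. c i = 0)) \<and>
     (\<forall>\<beta>. is_root h \<beta> \<longrightarrow>
        (\<exists>k :: 'i \<Rightarrow> int. ((\<forall>i. k i \<ge> 0) \<or> (\<forall>i. k i \<le> 0)) \<and>
           (\<forall>H\<in>h. \<beta> H = (\<Sum>i\<in>UNIV. of_int (k i) * \<alpha> i H))))"

end

locale simple_lie_algebra = complex_lie_algebra scale br
  for scale :: "complex \<Rightarrow> 'g::ab_group_add \<Rightarrow> 'g" and br +
  assumes nonabelian: "\<exists>x y. br x y \<noteq> 0"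
    and ideal_trivial: "lie_ideal I \<Longrightarrow> I = {0} \<or> I = UNIV"

text \<open>
  The index type \<open>'i\<close> plays the role of \<open>{1,\<dots>,r}\<close>: by the base
  property its cardinality is the rank.
\<close>

locale simple_lie_algebra_with_base = simple_lie_algebra scale br
  for scale :: "complex \<Rightarrow> 'g::ab_group_add \<Rightarrow> 'g" and br +
  fixes h :: "'g set"
    and \<alpha> :: "'i::finite \<Rightarrow> 'g \<Rightarrow> complex"
    and coroot :: "'i \<Rightarrow> 'g"
  assumes cartan: "cartan_subalgebra h"
    and base: "is_base h \<alpha>"
    and coroot: "is_coroot h (\<alpha> i) (coroot i)"

definition cartan_matrix :: "('i \<Rightarrow> 'g \<Rightarrow> complex) \<Rightarrow> ('i \<Rightarrow> 'g) \<Rightarrow> 'i \<Rightarrow> 'i \<Rightarrow> int" where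
  "cartan_matrix \<alpha> coroot i j = (THE n. of_int n = \<alpha> j (coroot i))"

text \<open>
  The next lemmas show that the entries are integers, nonpositive off the
  diagonal, so that \<open>THE\<close> above and the exponents \<open>nat (- a j i)\<close> below are
  meaningful, and that vanishing is symmetric in \<open>i\<close> and \<open>j\<close>.
\<close>

context complex_lie_algebra
begin

lemma br_zero_right [simp]: "br x 0 = 0"
  using br_add_right[of x 0 0] by simp

lemma br_zero_left [simp]: "br 0 x = 0"
  using br_add_left[of 0 0 x] by simp

lemma br_anti: "br x y = - br y x"
proof -
  have "br (x + y) (x + y) = br x y + br y x"
    using br_add_left[of x y "x + y"] br_add_right[of x x y] br_add_right[of y x y]
    by (simp add: br_self[of x] br_self[of y])
  then have "br x y + br y x = 0"
    by (simp only: br_self)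
  then show ?thesis by (simp add: eq_neg_iff_add_eq_0)
qed

lemma br_minus_right: "br x (- y) = - br x y"
  using br_add_right[of x y "- y"] by (simp add: eq_neg_iff_add_eq_0 add.commute)

lemma br_minus_left: "br (- x) y = - br x y"
  using br_add_left[of x "- x" y] by (simp add: eq_neg_iff_add_eq_0 add.commute)

lemma br_sum_right: "br x (\<Sum>i\<in>I. g i) = (\<Sum>i\<in>I. br x (g i))"
  by (induction I rule: infinite_finite_induct) (auto simp: br_add_right)

lemma br_derivation: "br x (br y z) = br (br x y) z + br y (br x z)"
proof -
  have "br y (br z x) = - br y (br x z)" "br z (br x y) = - br (br x y) z"
    by (simp_all only: br_anti[of z x] br_minus_right br_anti[of z "br x y"])
  then show ?thesis
    using jacobi[of x y z] by (simp add: algebra_simps)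
qed

lemma eigenvectors_independent:
  fixes n k :: nat
  assumes eig: "\<And>k. br H (v k) = scale (l k) (v k)"
    and nz: "\<And>k. v k \<noteq> 0" and inj: "inj l"
  shows "(\<Sum>k<n. scale (c k) (v k)) = 0 \<Longrightarrow> k < n \<Longrightarrow> c k = 0"
proof (induction n arbitrary: c k)
  case (Suc n)
  have s: "scale (c n) (v n) = - (\<Sum>k<n. scale (c k) (v k))"
    using Suc.prems(1) by (simp add: eq_neg_iff_add_eq_0 add.commute)
  have "0 = br H (\<Sum>k<Suc n. scale (c k) (v k)) - scale (l n) (\<Sum>k<Suc n. scale (c k) (v k))"
    using Suc.prems(1) by simp
  also have "\<dots> = (\<Sum>k<Suc n. br H (scale (c k) (v k)) - scale (l n) (scale (c k) (v k)))"
    by (simp only: br_sum_right scale_sum_right sum_subtractf)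
  also have "\<dots> = (\<Sum>k<Suc n. scale (c k * (l k - l n)) (v k))"
    by (simp only: br_scale_right eig scale_scale scale_left_diff_distrib[symmetric]
        right_diff_distrib mult.commute[of "l n"])
  also have "\<dots> = (\<Sum>k<n. scale (c k * (l k - l n)) (v k))"
    by simp
  finally have z: "c k = 0" if "k < n" for k
    using Suc.IH[of "\<lambda>k. c k * (l k - l n)" k] that inj by (auto simp: inj_def)
  then have "scale (c n) (v n) = 0" using s by simp
  then have "c n = 0" using nz by (simp add: scale_eq_0_iff)
  then show ?case using z Suc.prems(2) by (cases "k = n") auto
qed simp

lemma eigenvector_sequence_vanishes:
  assumes eig: "\<And>k::nat. br H (v k) = scale (l k) (v k)" and inj: "inj l"
  shows "\<exists>k. v k = 0"
proof (rule ccontr)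
  assume "\<nexists>k. v k = 0"
  then have nz: "\<And>k. v k \<noteq> 0" by simp
  have injv: "inj v"
  proof (rule injI)
    fix i j assume ij: "v i = v j"
    then have "scale (l i - l j) (v i) = 0"
      using eig[of i] eig[of j] by (metis scale_left_diff_distrib right_minus_eq)
    then have "l i - l j = 0" using nz[of i] scale_eq_0_iff by blast
    then show "i = j" using inj by (simp add: inj_eq)
  qed
  obtain B where B: "finite B" "span B = UNIV" using finite_dim by blast
  define n where "n = Suc (card B)"
  have "independent (v ` {..<n})"
  proof
    assume "dependent (v ` {..<n})"
    then obtain u x where u: "(\<Sum>y\<in>v ` {..<n}. scale (u y) y) = 0" "x \<in> v ` {..<n}" "u x \<noteq> 0"
      by (auto simp: dependent_finite)
    have "(\<Sum>k<n. scale (u (v k)) (v k)) = 0"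
      using u(1) injv by (simp add: sum.reindex inj_on_subset)
    then show False
      using eigenvectors_independent[OF eig nz inj, of "\<lambda>k. u (v k)" n] u(2,3) by auto
  qed
  then have "card (v ` {..<n}) \<le> card B"
    using independent_span_bound[OF B(1)] B(2) by simp
  then show False using injv by (simp add: n_def card_image inj_on_subset)
qed

lemma lowest_weight_integer:
  assumes he: "br H e = scale 2 e" and ef: "br e f = H"
    and hv: "br H v = scale a v" and fv: "br f v = 0" and v: "v \<noteq> 0"
  shows "\<exists>m::nat. a = - of_nat m \<and> (m = 0 \<longleftrightarrow> br e v = 0)"
proof -
  define w where "w k = ((br e) ^^ k) v" for k
  have w0: "w 0 = v" and wS: "w (Suc k) = br e (w k)" for k by (simp_all add: w_def)
  have hw: "br H (w k) = scale (a + 2 * of_nat k) (w k)" for k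
  proof (induction k)
    case (Suc k)
    have "br H (w (Suc k)) = br (br H e) (w k) + br e (br H (w k))"
      by (simp add: wS br_derivation[of H e])
    also have "\<dots> = scale (2 + (a + 2 * of_nat k)) (w (Suc k))"
      by (simp only: he Suc br_scale_left br_scale_right wS scale_left_distrib[symmetric])
    finally show ?case by (simp add: algebra_simps)
  qed (simp add: w0 hv)
  have fe: "br f e = - H" using br_anti[of f e] ef by simp
  have fw: "br f (w (Suc k)) = scale (- (of_nat (Suc k) * (a + of_nat k))) (w k)" for k
  proof (induction k)
    case 0
    show ?case
      using br_derivation[of f e v] by (simp add: wS w0 fv fe br_minus_left hv scale_minus_left)
  next
    case (Suc k)
    have "br f (w (Suc (Suc k))) = br (br f e) (w (Suc k)) + br e (br f (w (Suc k)))"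
      by (simp add: wS[of "Suc k"] br_derivation[of f e])
    also have "\<dots> = scale (- (a + 2 * of_nat (Suc k))) (w (Suc k))
        + scale (- (of_nat (Suc k) * (a + of_nat k))) (w (Suc k))"
      by (simp only: Suc br_scale_right br_minus_right wS[of k, symmetric] fe br_minus_left hw
          scale_minus_left)
    also have "\<dots> = scale (- (of_nat (Suc (Suc k)) * (a + of_nat (Suc k)))) (w (Suc k))"
      by (simp only: scale_left_distrib[symmetric]) (rule arg_cong[where f = "\<lambda>c. scale c _"], simp add: algebra_simps)
    finally show ?case .
  qed
  have "\<exists>k. w k = 0"
    by (rule eigenvector_sequence_vanishes[OF hw]) (auto simp: inj_def)
  then have ex: "\<exists>m. w (Suc m) = 0"
    using w0 v by (metis not0_implies_Suc)
  define m where "m = (LEAST m. w (Suc m) = 0)"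
  have m: "w (Suc m) = 0" unfolding m_def using ex by (rule LeastI_ex)
  have "w m \<noteq> 0"
  proof (cases m)
    case 0 then show ?thesis using w0 v by simp
  next
    case (Suc k) then show ?thesis using not_less_Least[of k "\<lambda>m. w (Suc m) = 0"] m_def by auto
  qed
  then have "of_nat (Suc m) * (a + of_nat m) = 0"
    using fw[of m] m by (simp add: scale_eq_0_iff del: of_nat_Suc)
  then have "a + of_nat m = 0"
    by (simp del: of_nat_Suc)
  moreover have "m = 0 \<longleftrightarrow> br e v = 0"
  proof
    show "m = 0 \<Longrightarrow> br e v = 0" using m wS[of 0] w0 by simp
    show "br e v = 0 \<Longrightarrow> m = 0"
      unfolding m_def by (rule Least_eq_0) (simp add: wS w0)
  qed
  ultimately show ?thesis by (auto simp: eq_neg_iff_add_eq_0)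
qed

end

context simple_lie_algebra_with_base
begin

lemma difference_not_root:
  assumes "i \<noteq> j"
  shows "root_space h (\<lambda>H. \<alpha> j H - \<alpha> i H) \<subseteq> {0}"
proof (rule ccontr)
  let ?b = "\<lambda>H. \<alpha> j H - \<alpha> i H"
  assume a: "\<not> root_space h ?b \<subseteq> {0}"
  have indep: "c k = 0" if "\<forall>H\<in>h. (\<Sum>i\<in>UNIV. c i * \<alpha> i H) = 0" for c k
    using base that unfolding is_base_def by blast
  have sum_diff: "(\<Sum>l\<in>UNIV. ((if l = j then 1 else 0) - (if l = i then 1 else 0)) * \<alpha> l H) = ?b H" for H
    by (simp add: algebra_simps sum_subtractf if_distrib[of "\<lambda>x. x * _"] if_distrib[of "\<lambda>x. _ * x"] cong: if_cong)
  have nz: "\<exists>H\<in>h. ?b H \<noteq> 0"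
  proof (rule ccontr)
    assume "\<not> (\<exists>H\<in>h. ?b H \<noteq> 0)"
    then have "((if j = j then 1 else 0) - (if j = i then 1 else 0) :: complex) = 0"
      by (intro indep[of "\<lambda>l. (if l = j then 1 else 0) - (if l = i then 1 else 0)"])
        (simp only: sum_diff, blast)
    then show False using assms by simp
  qed
  have fn: "functional_on h (\<alpha> k)" for k using base by (auto simp: is_base_def is_root_def)
  have "functional_on h ?b" using fn[of i] fn[of j] by (auto simp: functional_on_def algebra_simps)
  with nz a have "is_root h ?b" by (auto simp: is_root_def)
  then obtain k :: "'i \<Rightarrow> int" where k: "(\<forall>i. k i \<ge> 0) \<or> (\<forall>i. k i \<le> 0)"
    "\<forall>H\<in>h. ?b H = (\<Sum>i\<in>UNIV. of_int (k i) * \<alpha> i H)"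
    using base unfolding is_base_def by blast
  have "\<forall>H\<in>h. (\<Sum>l\<in>UNIV. (of_int (k l) - ((if l = j then 1 else 0) - (if l = i then 1 else 0))) * \<alpha> l H) = 0"
    using k(2) by (simp only: left_diff_distrib[of "of_int _"] sum_subtractf sum_diff) simp
  from indep[OF this] have "of_int (k l) = (if l = j then 1 else 0 :: complex) - (if l = i then 1 else 0)" for l
    by (simp only: eq_iff_diff_eq_0[symmetric] right_minus_eq)
  from this[of i] this[of j] assms have "of_int (k i) = (of_int (-1) :: complex)" "of_int (k j) = (of_int 1 :: complex)"
    by simp_all
  then have "k i = -1" "k j = 1" by (simp_all only: of_int_eq_iff)
  then show False using k(1) by (metis not_one_le_zero neg_0_le_iff_le)
qed

lemma cartan_entry_nonpos:
  assumes "i \<noteq> j" and v: "v \<in> root_space h (\<alpha> j)" "v \<noteq> 0"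
    and e: "e \<in> root_space h (\<alpha> i)" and f: "f \<in> root_space h (\<lambda>H. - \<alpha> i H)"
    and ef: "br e f = coroot i"
  shows "\<exists>m::nat. \<alpha> j (coroot i) = - of_nat m \<and> (m = 0 \<longleftrightarrow> br e v = 0)"
proof -
  have c: "coroot i \<in> h" "\<alpha> i (coroot i) = 2"
    using coroot[of i] by (auto simp: is_coroot_def)
  have "br H (br f v) = scale (\<alpha> j H - \<alpha> i H) (br f v)" if "H \<in> h" for H
    using f v(1) that
    by (simp add: br_derivation[of H f] root_space_def br_scale_left br_scale_right
        br_minus_left scale_left_diff_distrib)
  then have "br f v = 0" using difference_not_root[OF \<open>i \<noteq> j\<close>] by (auto simp: root_space_def)
  moreover have "br (coroot i) e = scale 2 e" "br (coroot i) v = scale (\<alpha> j (coroot i)) v"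
    using c e v by (auto simp: root_space_def)
  ultimately show ?thesis using lowest_weight_integer[of "coroot i" e f v] ef v(2) by blast
qed

lemma coroot_sl2:
  obtains e f where "e \<in> root_space h (\<alpha> i)" "e \<noteq> 0"
    "f \<in> root_space h (\<lambda>H. - \<alpha> i H)" "br e f = coroot i"
proof -
  obtain e f where ef: "coroot i \<in> h" "\<alpha> i (coroot i) = 2" "e \<in> root_space h (\<alpha> i)"
      "f \<in> root_space h (\<lambda>H. - \<alpha> i H)" "br e f = coroot i"
    using coroot[of i] by (auto simp: is_coroot_def)
  have "functional_on h (\<alpha> i)" using base by (auto simp: is_base_def is_root_def)
  then have "\<alpha> i (scale 0 (coroot i)) = 0 * \<alpha> i (coroot i)"
    using ef(1) unfolding functional_on_def by blast
  then have "coroot i \<noteq> 0" using ef(2) by auto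
  then show ?thesis using that ef by force
qed

lemma cartan_matrix_diag: "cartan_matrix \<alpha> coroot i i = 2"
proof -
  have "\<alpha> i (coroot i) = of_int 2" using coroot[of i] by (simp add: is_coroot_def)
  then show ?thesis unfolding cartan_matrix_def by (simp only: of_int_eq_iff the_eq_trivial)
qed

lemma cartan_matrix_nonpos: "i \<noteq> j \<Longrightarrow> cartan_matrix \<alpha> coroot i j \<le> 0"
  and of_int_cartan_matrix: "of_int (cartan_matrix \<alpha> coroot i j) = \<alpha> j (coroot i)"
proof -
  have *: "cartan_matrix \<alpha> coroot i j \<le> 0 \<and> of_int (cartan_matrix \<alpha> coroot i j) = \<alpha> j (coroot i)"
    if "i \<noteq> j"
  proof -
    obtain e f where "e \<in> root_space h (\<alpha> i)" "f \<in> root_space h (\<lambda>H. - \<alpha> i H)"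
      "br e f = coroot i"
      using coroot_sl2[of i] by metis
    moreover obtain v where "v \<in> root_space h (\<alpha> j)" "v \<noteq> 0"
      using coroot_sl2[of j] by metis
    ultimately obtain m :: nat where m: "\<alpha> j (coroot i) = of_int (- int m)"
      using cartan_entry_nonpos[OF \<open>i \<noteq> j\<close>] by fastforce
    then have "cartan_matrix \<alpha> coroot i j = - int m"
      unfolding cartan_matrix_def by (simp only: of_int_eq_iff the_eq_trivial)
    then show ?thesis using m by simp
  qed
  then show "i \<noteq> j \<Longrightarrow> cartan_matrix \<alpha> coroot i j \<le> 0" by blast
  show "of_int (cartan_matrix \<alpha> coroot i j) = \<alpha> j (coroot i)"
    using * cartan_matrix_diag[of i] coroot[of i] by (cases "i = j") (auto simp: is_coroot_def)
qed

lemma cartan_matrix_zero_sym: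
  assumes "cartan_matrix \<alpha> coroot i j = 0"
  shows "cartan_matrix \<alpha> coroot j i = 0"
proof -
  have ij: "i \<noteq> j" using assms cartan_matrix_diag by force
  obtain e f where ef: "e \<in> root_space h (\<alpha> i)" "e \<noteq> 0"
    "f \<in> root_space h (\<lambda>H. - \<alpha> i H)" "br e f = coroot i" by (rule coroot_sl2)
  obtain e' f' where ef': "e' \<in> root_space h (\<alpha> j)" "e' \<noteq> 0"
    "f' \<in> root_space h (\<lambda>H. - \<alpha> j H)" "br e' f' = coroot j" by (rule coroot_sl2)
  have "br e e' = 0"
    using cartan_entry_nonpos[OF ij ef'(1,2) ef(1,3,4)] of_int_cartan_matrix[of i j] assms by auto
  then have "br e' e = 0" using br_anti[of e' e] by simp
  then have "\<alpha> i (coroot j) = 0"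
    using cartan_entry_nonpos[OF ij[symmetric] ef(1,2) ef'(1,3,4)] by auto
  then show ?thesis using of_int_cartan_matrix[of j i] by simp
qed

end


section \<open>The qq-system and the Bethe Ansatz equations\<close>

text \<open>
  Below, \<open>a\<close> is the Cartan matrix, \<open>\<zeta> i\<close> is the value of the simple root
  \<open>\<alpha> i\<close> on \<open>Z\<close>.
\<close>

definition wronskian :: "complex poly \<Rightarrow> complex poly \<Rightarrow> complex poly" where
  "wronskian p q = p * pderiv q - q * pderiv p"

definition qq_system ::
  "('i::finite \<Rightarrow> 'i \<Rightarrow> int) \<Rightarrow> ('i \<Rightarrow> complex) \<Rightarrow> ('i \<Rightarrow> complex poly) \<Rightarrow>
   ('i \<Rightarrow> complex poly) \<Rightarrow> ('i \<Rightarrow> complex poly) \<Rightarrow> bool" where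
  "qq_system a \<zeta> \<Lambda> qp qm \<longleftrightarrow>
     (\<forall>i. wronskian (qp i) (qm i) + smult (\<zeta> i) (qp i * qm i) =
          \<Lambda> i * (\<Prod>j\<in>UNIV - {i}. qp j ^ nat (- a j i)))"

definition nondegenerate ::
  "('i \<Rightarrow> 'i \<Rightarrow> int) \<Rightarrow> ('i \<Rightarrow> complex poly) \<Rightarrow> ('i \<Rightarrow> complex poly) \<Rightarrow> bool" where
  "nondegenerate a \<Lambda> qp \<longleftrightarrow>
     (\<forall>i. lead_coeff (qp i) = 1) \<and>
     (\<forall>i z. order z (qp i) \<le> 1) \<and>
     (\<forall>i. \<nexists>z. poly (qp i) z = 0 \<and> poly (\<Lambda> i) z = 0) \<and>
     (\<forall>i j. i \<noteq> j \<and> a i j \<noteq> 0 \<longrightarrow> (\<nexists>z. poly (qp i) z = 0 \<and> poly (qp j) z = 0))"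

definition nondegenerate_qq_solutions ::
  "('i::finite \<Rightarrow> 'i \<Rightarrow> int) \<Rightarrow> ('i \<Rightarrow> complex) \<Rightarrow> ('i \<Rightarrow> complex poly) \<Rightarrow>
   (('i \<Rightarrow> complex poly) \<times> ('i \<Rightarrow> complex poly)) set" where
  "nondegenerate_qq_solutions a \<zeta> \<Lambda> =
     {(qp, qm). qq_system a \<zeta> \<Lambda> qp qm \<and> nondegenerate a \<Lambda> qp}"

definition monic_with_roots :: "complex multiset \<Rightarrow> complex poly" where
  "monic_with_roots M = (\<Prod>w\<in>#M. [:- w, 1:])"

text \<open>
  The function whose logarithmic derivative enters the Bethe Ansatz equation at
  \<open>w\<close>. Since \<open>a i i = 2\<close>, it has a removable singularity at the simple root \<open>w\<close>
  of \<open>q i\<close>, where the HOL expression itself has the value 0.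
\<close>

definition bethe_function ::
  "('i::finite \<Rightarrow> 'i \<Rightarrow> int) \<Rightarrow> ('i \<Rightarrow> complex poly) \<Rightarrow> ('i \<Rightarrow> complex poly) \<Rightarrow>
   'i \<Rightarrow> complex \<Rightarrow> complex \<Rightarrow> complex" where
  "bethe_function a \<Lambda> q i w z =
     poly (\<Lambda> i) z * (\<Prod>j\<in>UNIV. poly (q j) z powi (- a j i)) * (z - w)\<^sup>2"

text \<open>
  Because of that singularity, the rational function
  \<open>\<partial> log F = F' / F\<close> is evaluated at \<open>w\<close> as a limit.
\<close>

definition bethe_equation ::
  "('i::finite \<Rightarrow> 'i \<Rightarrow> int) \<Rightarrow> ('i \<Rightarrow> complex) \<Rightarrow> ('i \<Rightarrow> complex poly) \<Rightarrow>
   ('i \<Rightarrow> complex poly) \<Rightarrow> 'i \<Rightarrow> complex \<Rightarrow> bool" where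
  "bethe_equation a \<zeta> \<Lambda> q i w \<longleftrightarrow>
     ((\<lambda>z. \<zeta> i + deriv (bethe_function a \<Lambda> q i w) z / bethe_function a \<Lambda> q i w z)
        \<longlongrightarrow> 0) (at w)"

text \<open>
  The unordered collections are multisets. In the second condition, removing
  one copy of \<open>w\<close> when \<open>i = j\<close> accounts for the requirement
  \<open>(i,l) \<noteq> (j,s)\<close> on the labels of the two numbers compared.
\<close>

definition bethe_solutions ::
  "('i::finite \<Rightarrow> 'i \<Rightarrow> int) \<Rightarrow> ('i \<Rightarrow> complex) \<Rightarrow> ('i \<Rightarrow> complex poly) \<Rightarrow>
   ('i \<Rightarrow> complex multiset) set" where
  "bethe_solutions a \<zeta> \<Lambda> =
     {W. (\<forall>i. \<forall>w\<in>#W i. poly (\<Lambda> i) w \<noteq> 0) \<and>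
         (\<forall>i j. a j i \<noteq> 0 \<longrightarrow> (\<forall>w\<in>#W i. w \<notin># (if i = j then W j - {#w#} else W j))) \<and>
         (\<forall>i. \<forall>w\<in>#W i. bethe_equation a \<zeta> \<Lambda> (\<lambda>j. monic_with_roots (W j)) i w)}"

end

theory Submission
  imports Defs "HOL-Computational_Algebra.Fundamental_Theorem_Algebra"
begin

text \<open>
  For fixed \<open>i\<close> the qq-equation is an inhomogeneous linear equation \<open>L r = P\<close> for
  \<open>r = q_-\<close>, where \<open>L r = q r' - q' r + \<zeta> q r\<close> and \<open>q = q_+\<close> is squarefree. The
  combination \<open>P' q' + \<zeta> P q' - P q''\<close> vanishes at the roots of \<open>q\<close> whenever \<open>P = L r\<close>;
  divided by \<open>P q'\<close> it is the left-hand side of the Bethe equation. Conversely, interpolation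
  at the roots of \<open>q\<close> gives \<open>s\<close> such that \<open>P - L s\<close> vanishes there, and
  the Bethe equations make these zeros double. So \<open>P - L s = q\<^sup>2 T\<close>, and since
  \<open>L (q u) = q\<^sup>2 (u' + \<zeta> u)\<close> it remains to solve \<open>u' + \<zeta> u = T\<close>, which is
  possible for every \<open>T\<close>, uniquely if \<open>\<zeta> \<noteq> 0\<close> and up to a constant if \<open>\<zeta> = 0\<close>.
  The kernel of \<open>L\<close> is likewise \<open>q\<close> times the kernel of \<open>u \<mapsto> u' + \<zeta> u\<close>.
\<close>

section \<open>Monic polynomials and multisets of roots\<close>

lemma monic_with_roots_nonzero [simp]: "monic_with_roots M \<noteq> 0"
  by (auto simp: monic_with_roots_def)

lemma lead_coeff_monic_with_roots [simp]: "lead_coeff (monic_with_roots M) = 1"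
  by (induction M) (simp_all add: monic_with_roots_def lead_coeff_mult del: mult_pCons_left)

lemma proots_monic_with_roots [simp]: "proots (monic_with_roots M) = M"
proof (induction M)
  case (add x M)
  have "monic_with_roots (add_mset x M) = [:- x, 1:] * monic_with_roots M"
    by (simp add: monic_with_roots_def)
  then show ?case
    using add by (simp add: proots_mult del: mult_pCons_left)
qed (simp add: monic_with_roots_def)

lemma poly_monic_with_roots_eq_0_iff [simp]: "poly (monic_with_roots M) z = 0 \<longleftrightarrow> z \<in># M"
  using set_count_proots[OF monic_with_roots_nonzero, of M] by simp

lemma order_monic_with_roots [simp]: "order z (monic_with_roots M) = count M z"
  using count_proots[OF monic_with_roots_nonzero, of M z] by simp

lemma monic_with_roots_of_proots:
  assumes "lead_coeff p = 1"
  shows "monic_with_roots (proots p) = p"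
  using complex_poly_decompose_multiset[of p] assms by (simp add: monic_with_roots_def)

section \<open>Divisibility and interpolation at distinct roots\<close>

lemma prod_linear_dvd:
  fixes p :: "'a::field poly"
  assumes "finite A" and "\<And>w. w \<in> A \<Longrightarrow> poly p w = 0"
  shows "(\<Prod>w\<in>A. [:- w, 1:]) dvd p"
  using assms
proof (induction A)
  case (insert x A)
  then obtain k where k: "p = (\<Prod>w\<in>A. [:- w, 1:]) * k"
    by (auto elim: dvdE)
  \<comment> \<open>The points are distinct, so the old factors do not vanish at \<open>x\<close>;
    the zero of \<open>p\<close> at \<open>x\<close> must come from the cofactor
    \<open>k\<close>.\<close>
  have "poly (\<Prod>w\<in>A. [:- w, 1:]) x \<noteq> 0"
    using insert.hyps by (auto simp: poly_prod)
  then have "poly k x = 0"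
    using insert.prems[of x] k by simp
  then have "[:- x, 1:] dvd k"
    by (simp add: poly_eq_0_iff_dvd)
  then show ?case
    using insert.hyps k by (metis mult.commute mult_dvd_mono dvd_refl prod.insert)
qed simp

text \<open>Up to its leading coefficient, a squarefree complex polynomial is the product of
  \<open>z - w\<close> over its distinct roots, so \<open>prod_linear_dvd\<close> applies.\<close>

lemma rsquarefree_dvd:
  fixes q :: "complex poly"
  assumes "rsquarefree q" and "\<And>w. poly q w = 0 \<Longrightarrow> poly p w = 0"
  shows "q dvd p"
proof -
  have nz: "q \<noteq> 0"
    using assms(1) by (simp add: rsquarefree_def)
  have "(\<Prod>w | poly q w = 0. [:- w, 1:]) dvd p"
    using assms(2) nz by (intro prod_linear_dvd poly_roots_finite) auto
  then have "smult (lead_coeff q) (\<Prod>w | poly q w = 0. [:- w, 1:]) dvd p"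
    using nz by (simp add: smult_dvd_iff)
  then show ?thesis
    by (simp only: complex_poly_decompose_rsquarefree[OF assms(1)])
qed

lemma interpolation:
  fixes f :: "'a::field \<Rightarrow> 'a"
  assumes "finite A"
  shows "\<exists>s. \<forall>w\<in>A. poly s w = f w"
  using assms
proof (induction A)
  case (insert x A)
  then obtain s where s: "\<forall>w\<in>A. poly s w = f w" by blast
  \<comment> \<open>\<open>m\<close> vanishes on \<open>A\<close> but not at \<open>x\<close>:
    adding a multiple of it corrects the value at \<open>x\<close> and keeps the values on
    \<open>A\<close>.\<close>
  define m where "m = (\<Prod>w\<in>A. [:- w, 1:])"
  have m: "poly m x \<noteq> 0" "\<forall>w\<in>A. poly m w = 0"
    using insert.hyps by (auto simp: m_def poly_prod)
  have "\<forall>w\<in>insert x A. poly (s + smult ((f x - poly s x) / poly m x) m) w = f w"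
    using s m by simp
  then show ?case by blast
qed simp

section \<open>The polynomial equation \<open>u' + \<zeta> u = T\<close>\<close>

lemma pderiv_surj:
  fixes T :: "'a::field_char_0 poly"
  shows "\<exists>u. pderiv u = T"
proof (induction "degree T" arbitrary: T rule: less_induct)
  case less
  define n where "n = degree T"
  \<comment> \<open>\<open>v\<close> integrates the leading term of \<open>T\<close>; what remains
    has smaller degree unless \<open>T\<close> is constant.\<close>
  define v where "v = monom (lead_coeff T / of_nat (Suc n)) (Suc n)"
  have v: "pderiv v = monom (lead_coeff T) n"
    by (simp add: v_def pderiv_monom del: of_nat_Suc)
  show ?case
  proof (cases "n = 0")
    case True
    then have "T = monom (lead_coeff T) n"
      by (metis degree_0_id monom_0 n_def)
    then show ?thesis using v by metis
  next
    case False
    have "degree (T - monom (lead_coeff T) n) < degree T"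
    proof (rule degree_lessI)
      show "T - monom (lead_coeff T) n \<noteq> 0 \<or> 0 < degree T" using False n_def by simp
      show "\<forall>k\<ge>degree T. coeff (T - monom (lead_coeff T) n) k = 0"
        by (auto simp: n_def coeff_eq_0)
    qed
    then obtain u where "pderiv u = T - monom (lead_coeff T) n"
      using less by blast
    then have "pderiv (u + v) = T"
      using v by (simp add: pderiv_add)
    then show ?thesis by blast
  qed
qed

text \<open>For \<open>\<zeta> \<noteq> 0\<close>, if \<open>u\<close> solves the equation with
  right-hand side \<open>pderiv T\<close>, then \<open>(T - u) / \<zeta>\<close> has derivative
  \<open>u\<close> and therefore solves it for \<open>T\<close>. Differentiation lowers the degree
  until \<open>T\<close> is constant.\<close>

lemma pderiv_plus_smult_surj:
  fixes T :: "'a::field_char_0 poly"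
  shows "\<exists>u. pderiv u + smult \<zeta> u = T"
proof (cases "\<zeta> = 0")
  case True
  then show ?thesis using pderiv_surj[of T] by simp
next
  case False
  show ?thesis
  proof (induction "degree T" arbitrary: T rule: less_induct)
    case less
    show ?case
    proof (cases "degree T = 0")
      case True
      then have "pderiv (smult (1 / \<zeta>) T) + smult \<zeta> (smult (1 / \<zeta>) T) = T"
        using False by (simp add: pderiv_smult pderiv_eq_0_iff)
      then show ?thesis by blast
    next
      case deg: False
      then obtain u where u: "pderiv u + smult \<zeta> u = pderiv T"
        using less[of "pderiv T"] by (auto simp: degree_pderiv)
      have "pderiv (smult (1 / \<zeta>) (T - u)) + smult \<zeta> (smult (1 / \<zeta>) (T - u)) = T"
        using False by (simp add: pderiv_smult pderiv_diff u[symmetric] smult_add_right smult_diff_right)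
      then show ?thesis by blast
    qed
  qed
qed

text \<open>The derivative contributes nothing in degree \<open>degree u\<close>, so the coefficient
  there is \<open>\<zeta>\<close> times the leading coefficient of \<open>u\<close>.\<close>

lemma pderiv_plus_smult_eq_0:
  fixes u :: "'a::field_char_0 poly"
  assumes "pderiv u + smult \<zeta> u = 0"
  shows "\<exists>c. u = [:c:]" and "\<zeta> \<noteq> 0 \<Longrightarrow> u = 0"
proof -
  have *: "u = 0" if "\<zeta> \<noteq> 0"
  proof (rule ccontr)
    assume "u \<noteq> 0"
    have "coeff (pderiv u + smult \<zeta> u) (degree u) = \<zeta> * lead_coeff u"
      by (simp add: coeff_pderiv coeff_eq_0)
    then show False
      using assms \<open>u \<noteq> 0\<close> that by simp
  qed
  show "\<exists>c. u = [:c:]"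
    using * assms by (cases "\<zeta> = 0") (auto intro: pderiv_iszero)
  show "\<zeta> \<noteq> 0 \<Longrightarrow> u = 0" by (rule *)
qed

section \<open>A single qq-equation as a linear equation for \<open>q_-\<close>\<close>

definition qq_operator :: "complex \<Rightarrow> complex poly \<Rightarrow> complex poly \<Rightarrow> complex poly" where
  "qq_operator \<zeta> q r = wronskian q r + smult \<zeta> (q * r)"

lemma qq_operator_add: "qq_operator \<zeta> q (r + s) = qq_operator \<zeta> q r + qq_operator \<zeta> q s"
  by (simp add: qq_operator_def wronskian_def pderiv_add algebra_simps smult_add_right)

lemma qq_operator_diff: "qq_operator \<zeta> q (r - s) = qq_operator \<zeta> q r - qq_operator \<zeta> q s"
  using qq_operator_add[of \<zeta> q "r - s" s] by simp

text \<open>Reduction of order: in the Wronskian of \<open>q\<close> and \<open>q u\<close> the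
  terms \<open>q q' u\<close> cancel.\<close>

lemma qq_operator_mult: "qq_operator \<zeta> q (q * u) = q\<^sup>2 * (pderiv u + smult \<zeta> u)"
  by (simp add: qq_operator_def wronskian_def pderiv_mult algebra_simps power2_eq_square)

lemma qq_operator_smult_self: "qq_operator 0 q (smult c q) = 0"
  using qq_operator_mult[of 0 q "[:c:]"] by simp

text \<open>At a root of \<open>q\<close> the equation reads \<open>- q' r = 0\<close>, and
  \<open>q' \<noteq> 0\<close> at simple roots. Hence \<open>r = q u\<close>, and
  \<open>qq_operator_mult\<close> leads to the kernel of \<open>u' + \<zeta> u\<close>.\<close>

lemma qq_operator_kernel:
  assumes sf: "rsquarefree q" and 0: "qq_operator \<zeta> q r = 0"
  shows "\<exists>c. r = smult c q" and "\<zeta> \<noteq> 0 \<Longrightarrow> r = 0"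
proof -
  have "poly r w = 0" if "poly q w = 0" for w
  proof -
    have "poly (qq_operator \<zeta> q r) w = 0" using 0 by simp
    then show ?thesis
      using that sf[unfolded rsquarefree_roots] by (auto simp: qq_operator_def wronskian_def)
  qed
  then obtain u where u: "r = q * u"
    using rsquarefree_dvd[OF sf] by (meson dvdE)
  have "q \<noteq> 0" using sf by (simp add: rsquarefree_def)
  then have *: "pderiv u + smult \<zeta> u = 0"
    using 0 u by (simp add: qq_operator_mult)
  show "\<exists>c. r = smult c q"
    using pderiv_plus_smult_eq_0(1)[OF *] u by auto
  show "\<zeta> \<noteq> 0 \<Longrightarrow> r = 0"
    using pderiv_plus_smult_eq_0(2)[OF *] u by simp
qed

definition bethe_residue :: "complex \<Rightarrow> complex poly \<Rightarrow> complex poly \<Rightarrow> complex poly" where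
  "bethe_residue \<zeta> q P =
     pderiv P * pderiv q + smult \<zeta> (P * pderiv q) - P * pderiv (pderiv q)"

lemma bethe_residue_diff:
  "bethe_residue \<zeta> q (P - R) = bethe_residue \<zeta> q P - bethe_residue \<zeta> q R"
  by (simp add: bethe_residue_def pderiv_diff algebra_simps smult_diff_right)

text \<open>At a root of \<open>q\<close>, \<open>P = L r\<close> has the value
  \<open>- q' r\<close>. In \<open>P'\<close> the terms with \<open>r'\<close> cancel, leaving
  \<open>\<zeta> q' r - q'' r\<close>; substituting both values gives 0.\<close>

lemma bethe_residue_qq_operator:
  assumes "poly q w = 0"
  shows "poly (bethe_residue \<zeta> q (qq_operator \<zeta> q r)) w = 0"
  using assms
  by (simp add: bethe_residue_def qq_operator_def wronskian_def pderiv_mult pderiv_add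
      pderiv_diff pderiv_smult algebra_simps)

lemma qq_operator_solvable_iff:
  assumes sf: "rsquarefree q"
  shows "(\<exists>r. qq_operator \<zeta> q r = P) \<longleftrightarrow> (\<forall>w. poly q w = 0 \<longrightarrow> poly (bethe_residue \<zeta> q P) w = 0)"
proof
  assume "\<exists>r. qq_operator \<zeta> q r = P"
  then show "\<forall>w. poly q w = 0 \<longrightarrow> poly (bethe_residue \<zeta> q P) w = 0"
    using bethe_residue_qq_operator by blast
next
  assume res: "\<forall>w. poly q w = 0 \<longrightarrow> poly (bethe_residue \<zeta> q P) w = 0"
  have "q \<noteq> 0" using sf by (simp add: rsquarefree_def)
  \<comment> \<open>At a root of \<open>q\<close> the value of \<open>L s\<close> is
    \<open>- q' s\<close>, so this choice of \<open>s\<close> makes \<open>L s\<close> agree with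
    \<open>P\<close> there.\<close>
  then obtain s where s: "\<forall>w\<in>{w. poly q w = 0}. poly s w = - poly P w / poly (pderiv q) w"
    using interpolation[of "{w. poly q w = 0}" "\<lambda>w. - poly P w / poly (pderiv q) w"]
    by (auto simp: poly_roots_finite)
  define R where "R = P - qq_operator \<zeta> q s"
  have q': "poly (pderiv q) w \<noteq> 0" if "poly q w = 0" for w
    using that sf[unfolded rsquarefree_roots] by blast
  have R: "poly R w = 0" if "poly q w = 0" for w
    using s that q'[OF that] by (simp add: R_def qq_operator_def wronskian_def)
  have R': "poly (pderiv R) w = 0" if "poly q w = 0" for w
  proof -
    \<comment> \<open>The residue of \<open>P\<close> vanishes by assumption and that of
      \<open>L s\<close> by the necessity direction. As \<open>R\<close> vanishes at
      \<open>w\<close>, what is left of this residue is \<open>R' q'\<close>.\<close>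
    have "poly (bethe_residue \<zeta> q R) w = 0"
      using res that bethe_residue_qq_operator[OF that] by (simp add: R_def bethe_residue_diff)
    then show ?thesis
      using R[OF that] q'[OF that] by (simp add: bethe_residue_def)
  qed
  obtain R1 where R1: "R = q * R1"
    using rsquarefree_dvd[OF sf R] by (auto elim: dvdE)
  \<comment> \<open>At the roots of \<open>q\<close> one has \<open>R' = q' R1\<close>, so a second
    factor \<open>q\<close> splits off.\<close>
  have "poly R1 w = 0" if "poly q w = 0" for w
    using R'[OF that] that q'[OF that] by (simp add: R1 pderiv_mult)
  then obtain T where T: "R1 = q * T"
    using rsquarefree_dvd[OF sf] by (meson dvdE)
  obtain u where "pderiv u + smult \<zeta> u = T"
    using pderiv_plus_smult_surj by blast
  then have "qq_operator \<zeta> q (s + q * u) = P"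
    by (simp add: qq_operator_add qq_operator_mult power2_eq_square T[symmetric] R1[symmetric] mult.assoc)
      (simp add: R_def)
  then show "\<exists>r. qq_operator \<zeta> q r = P" by blast
qed

section \<open>The Bethe equation as vanishing of \<open>bethe_residue\<close>\<close>

definition qq_rhs ::
  "('i::finite \<Rightarrow> 'i \<Rightarrow> int) \<Rightarrow> ('i \<Rightarrow> complex poly) \<Rightarrow> ('i \<Rightarrow> complex poly) \<Rightarrow> 'i \<Rightarrow> complex poly" where
  "qq_rhs a \<Lambda> q i = \<Lambda> i * (\<Prod>j\<in>UNIV - {i}. q j ^ nat (- a j i))"

lemma qq_system_iff: "qq_system a \<zeta> \<Lambda> qp qm \<longleftrightarrow> (\<forall>i. qq_operator (\<zeta> i) (qp i) (qm i) = qq_rhs a \<Lambda> qp i)"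
  by (simp add: qq_system_def qq_operator_def qq_rhs_def)

text \<open>Write \<open>q i = (z - w) g\<close>. Near \<open>w\<close> the Bethe function is
  \<open>P / g^2\<close>, so the limit is \<open>\<zeta> i + P'/P - 2 g'/g\<close> at
  \<open>w\<close>. Since \<open>g = q'\<close> and \<open>2 g' = q''\<close> at \<open>w\<close>,
  this is the residue divided by \<open>P q'\<close>.\<close>

lemma bethe_equation_iff:
  fixes a :: "'i::finite \<Rightarrow> 'i \<Rightarrow> int"
  assumes diag: "a i i = 2" and nonpos: "\<And>j. j \<noteq> i \<Longrightarrow> a j i \<le> 0"
    and w: "poly (q i) w = 0" and q': "poly (pderiv (q i)) w \<noteq> 0"
    and P: "poly (qq_rhs a \<Lambda> q i) w \<noteq> 0"
  shows "bethe_equation a \<zeta> \<Lambda> q i w \<longleftrightarrow> poly (bethe_residue (\<zeta> i) (q i) (qq_rhs a \<Lambda> q i)) w = 0"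
proof -
  define P where "P = qq_rhs a \<Lambda> q i"
  define F where "F = bethe_function a \<Lambda> q i w"
  obtain g where g: "q i = [:- w, 1:] * g"
    using w by (auto simp: poly_eq_0_iff_dvd elim: dvdE)
  have g1: "poly (pderiv (q i)) w = poly g w"
    by (simp add: g pderiv_mult pderiv_pCons del: mult_pCons_left)
  have g2: "poly (pderiv (pderiv (q i))) w = 2 * poly (pderiv g) w"
    by (simp add: g pderiv_mult pderiv_add pderiv_pCons del: mult_pCons_left)
  have gw: "poly g w \<noteq> 0" using q' g1 by simp
  have Pw: "poly P w \<noteq> 0" using P P_def by simp
  \<comment> \<open>The factor \<open>j = i\<close> has exponent \<open>-2\<close>, and its double
    pole cancels \<open>(z - w)^2\<close>. At \<open>w\<close> itself \<open>F\<close> is 0, which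
    differs from the nonzero limit.\<close>
  have F: "F z = poly P z / (poly g z)\<^sup>2" if "z \<noteq> w" for z
  proof -
    have "(\<Prod>j\<in>UNIV. poly (q j) z powi (- a j i)) =
        poly (q i) z powi (- a i i) * (\<Prod>j\<in>UNIV - {i}. poly (q j) z powi (- a j i))"
      by (simp add: prod.remove)
    also have "(\<Prod>j\<in>UNIV - {i}. poly (q j) z powi (- a j i)) =
        (\<Prod>j\<in>UNIV - {i}. poly (q j) z ^ nat (- a j i))"
      using nonpos by (intro prod.cong) (auto simp: power_int_def)
    also have "poly (q i) z powi (- a i i) = 1 / ((z - w)\<^sup>2 * (poly g z)\<^sup>2)"
      by (simp add: diag power_int_minus g power_mult_distrib[symmetric] field_simps
          del: mult_pCons_left)
    finally show ?thesis
      using that by (simp add: F_def bethe_function_def P_def qq_rhs_def poly_prod)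
  qed
  define D where "D z = poly (pderiv P) z / poly P z - 2 * poly (pderiv g) z / poly g z" for z
  have "\<forall>\<^sub>F z in at w. poly g z \<noteq> 0 \<and> poly P z \<noteq> 0 \<and> z \<noteq> w"
    using gw Pw by (intro eventually_conj tendsto_imp_eventually_ne[where c = "poly g w"]
        tendsto_imp_eventually_ne[where c = "poly P w"] eventually_neq_at_within)
      (auto intro: tendsto_intros simp: isCont_def[symmetric])
  then have ev: "\<forall>\<^sub>F z in at w. \<zeta> i + deriv F z / F z = \<zeta> i + D z"
  proof eventually_elim
    case (elim z)
    have "((\<lambda>z. poly P z / (poly g z)\<^sup>2) has_field_derivative
        (poly (pderiv P) z * (poly g z)\<^sup>2 - poly P z * (2 * poly g z * poly (pderiv g) z)) /
          ((poly g z)\<^sup>2 * (poly g z)\<^sup>2)) (at z)"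
      using elim by (auto intro!: derivative_eq_intros)
    \<comment> \<open>The formula for \<open>F\<close> holds on the open set \<open>- {w}\<close>,
      which contains a neighbourhood of \<open>z\<close>; this is enough to transfer the
      derivative.\<close>
    then have "(F has_field_derivative
        (poly (pderiv P) z * (poly g z)\<^sup>2 - poly P z * (2 * poly g z * poly (pderiv g) z)) /
          ((poly g z)\<^sup>2 * (poly g z)\<^sup>2)) (at z)"
      using elim F by (rule_tac has_field_derivative_transform_within_open[where S = "- {w}"]) auto
    then have dF: "deriv F z = (poly (pderiv P) z * (poly g z)\<^sup>2
        - poly P z * (2 * poly g z * poly (pderiv g) z)) / ((poly g z)\<^sup>2 * (poly g z)\<^sup>2)"
      by (rule DERIV_imp_deriv)
    show ?case
      unfolding dF D_def using elim by (simp add: F field_simps power2_eq_square)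
  qed
  \<comment> \<open>\<open>D\<close> is continuous at \<open>w\<close>, because \<open>P\<close> and
    \<open>g\<close> do not vanish there.\<close>
  have lim: "((\<lambda>z. \<zeta> i + D z) \<longlongrightarrow> \<zeta> i + D w) (at w)"
    unfolding D_def using gw Pw by (intro tendsto_intros) auto
  have "bethe_equation a \<zeta> \<Lambda> q i w \<longleftrightarrow> ((\<lambda>z. \<zeta> i + D z) \<longlongrightarrow> 0) (at w)"
    unfolding bethe_equation_def F_def[symmetric] using ev by (rule tendsto_cong)
  also have "\<dots> \<longleftrightarrow> \<zeta> i + D w = 0"
    using lim tendsto_unique[OF trivial_limit_at lim] by metis
  also have "\<dots> \<longleftrightarrow> poly (bethe_residue (\<zeta> i) (q i) P) w = 0"
    using gw Pw by (simp add: D_def bethe_residue_def g1 g2 field_simps)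
  finally show ?thesis by (simp add: P_def)
qed

section \<open>Nondegeneracy in terms of roots\<close>

lemma poly_qq_rhs_nonzero:
  assumes nd: "nondegenerate a \<Lambda> q" and w: "poly (q i) w = 0"
  shows "poly (qq_rhs a \<Lambda> q i) w \<noteq> 0"
proof -
  have "poly (\<Lambda> i) w \<noteq> 0"
    using nd w by (auto simp: nondegenerate_def)
  \<comment> \<open>If \<open>a j i = 0\<close> the exponent is 0 and the factor is 1, even at a
    root of \<open>q j\<close>; otherwise condition (c) for the pair \<open>(j, i)\<close>
    applies.\<close>
  moreover have "poly (q j) w ^ nat (- a j i) \<noteq> 0" if "j \<noteq> i" for j
  proof (cases "a j i = 0")
    case False
    then have "poly (q j) w \<noteq> 0"
      using nd w that unfolding nondegenerate_def by blast
    then show ?thesis by simp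
  qed simp
  ultimately show ?thesis
    by (auto simp: qq_rhs_def poly_prod)
qed

lemma nondegenerate_imp_rsquarefree:
  assumes "nondegenerate a \<Lambda> q"
  shows "rsquarefree (q i)"
proof -
  have "q i \<noteq> 0" "order z (q i) \<le> 1" for z
    using assms by (auto simp: nondegenerate_def dest: spec[of _ i])
  then show ?thesis
    by (auto simp: rsquarefree_def le_Suc_eq)
qed

text \<open>The pairs \<open>i = j\<close> express simplicity of the roots, because
  \<open>a i i \<noteq> 0\<close>. For \<open>i \<noteq> j\<close> disjointness is symmetric, so
  swapping the indices turns \<open>a j i\<close> into \<open>a i j\<close>.\<close>

lemma nondegenerate_monic_with_roots:
  fixes a :: "'i \<Rightarrow> 'i \<Rightarrow> int"
  assumes diag: "\<And>i. a i i \<noteq> 0"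
  shows "nondegenerate a \<Lambda> (\<lambda>i. monic_with_roots (W i)) \<longleftrightarrow>
     (\<forall>i. \<forall>w\<in>#W i. poly (\<Lambda> i) w \<noteq> 0) \<and>
     (\<forall>i j. a j i \<noteq> 0 \<longrightarrow> (\<forall>w\<in>#W i. w \<notin># (if i = j then W j - {#w#} else W j)))"
    (is "?L \<longleftrightarrow> ?A \<and> ?B")
proof -
  have simple: "(\<forall>w\<in>#M. w \<notin># M - {#w#}) \<longleftrightarrow> (\<forall>w. count M w \<le> 1)" for M :: "complex multiset"
  proof -
    \<comment> \<open>A copy of \<open>w\<close> survives the removal of one copy exactly when its
      multiplicity is at least 2.\<close>
    have "(w \<in># M \<longrightarrow> w \<notin># M - {#w#}) \<longleftrightarrow> count M w \<le> 1" for w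
      by (auto simp flip: count_greater_zero_iff)
    then show ?thesis by blast
  qed
  have "?B \<longleftrightarrow> (\<forall>i. \<forall>w\<in>#W i. w \<notin># W i - {#w#}) \<and>
      (\<forall>i j. i \<noteq> j \<and> a j i \<noteq> 0 \<longrightarrow> (\<forall>w\<in>#W i. w \<notin># W j))"
    using diag by (auto split: if_splits)
  also have "\<dots> \<longleftrightarrow> (\<forall>i w. count (W i) w \<le> 1) \<and>
      (\<forall>i j. i \<noteq> j \<and> a i j \<noteq> 0 \<longrightarrow> (\<nexists>z. z \<in># W i \<and> z \<in># W j))"
    unfolding simple by metis
  finally show ?thesis
    by (auto simp: nondegenerate_def)
qed

section \<open>Correspondence between Bethe roots and qq-solutions\<close>

locale qq_data =
  fixes a :: "'i::finite \<Rightarrow> 'i \<Rightarrow> int" and \<zeta> :: "'i \<Rightarrow> complex" and \<Lambda> :: "'i \<Rightarrow> complex poly"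
  assumes diag: "a i i = 2" and nonpos: "i \<noteq> j \<Longrightarrow> a i j \<le> 0"
begin

text \<open>Once \<open>q_+\<close> is fixed, the qq-equations for different \<open>i\<close>
  decouple. Solvability of each in \<open>q_-\<close> is, by
  \<open>qq_operator_solvable_iff\<close>, the system of Bethe equations at the roots of
  \<open>q i\<close>.\<close>

lemma bethe_solutions_iff:
  "W \<in> bethe_solutions a \<zeta> \<Lambda> \<longleftrightarrow>
     nondegenerate a \<Lambda> (\<lambda>i. monic_with_roots (W i)) \<and>
     (\<exists>qm. qq_system a \<zeta> \<Lambda> (\<lambda>i. monic_with_roots (W i)) qm)"
proof -
  define q where "q = (\<lambda>i. monic_with_roots (W i))"
  have "(\<forall>i. \<forall>w\<in>#W i. bethe_equation a \<zeta> \<Lambda> q i w) \<longleftrightarrow> (\<exists>qm. qq_system a \<zeta> \<Lambda> q qm)"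
    if nd: "nondegenerate a \<Lambda> q"
  proof -
    have sf: "rsquarefree (q i)" for i
      using nondegenerate_imp_rsquarefree[OF nd] .
    have "bethe_equation a \<zeta> \<Lambda> q i w \<longleftrightarrow>
        poly (bethe_residue (\<zeta> i) (q i) (qq_rhs a \<Lambda> q i)) w = 0" if w: "w \<in># W i" for i w
    proof (rule bethe_equation_iff)
      show w0: "poly (q i) w = 0" using w by (simp add: q_def)
      then show "poly (pderiv (q i)) w \<noteq> 0"
        using sf[of i] by (simp add: rsquarefree_roots)
      show "poly (qq_rhs a \<Lambda> q i) w \<noteq> 0"
        using poly_qq_rhs_nonzero[OF nd w0] .
    qed (use diag nonpos in auto)
    then have "(\<forall>i. \<forall>w\<in>#W i. bethe_equation a \<zeta> \<Lambda> q i w) \<longleftrightarrow>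
        (\<forall>i. \<exists>r. qq_operator (\<zeta> i) (q i) r = qq_rhs a \<Lambda> q i)"
      by (simp add: qq_operator_solvable_iff[OF sf]) (auto simp: q_def)
    then show ?thesis
      by (simp add: qq_system_iff) metis
  qed
  moreover have "W \<in> bethe_solutions a \<zeta> \<Lambda> \<longleftrightarrow>
      nondegenerate a \<Lambda> q \<and> (\<forall>i. \<forall>w\<in>#W i. bethe_equation a \<zeta> \<Lambda> q i w)"
    unfolding q_def
    by (subst nondegenerate_monic_with_roots) (auto simp: bethe_solutions_def diag)
  ultimately show ?thesis
    unfolding q_def by blast
qed

text \<open>Monic complex polynomials split, so \<open>proots\<close> recovers the collections; it
  also inverts \<open>monic_with_roots\<close>, which gives uniqueness.\<close>

lemma bethe_roots_ex1:
  assumes "(qp, qm) \<in> nondegenerate_qq_solutions a \<zeta> \<Lambda>"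
  shows "\<exists>!W. W \<in> bethe_solutions a \<zeta> \<Lambda> \<and> qp = (\<lambda>i. monic_with_roots (W i))"
proof
  have "qp = (\<lambda>i. monic_with_roots (proots (qp i)))"
    using assms by (simp add: nondegenerate_qq_solutions_def nondegenerate_def monic_with_roots_of_proots)
  then show "(\<lambda>i. proots (qp i)) \<in> bethe_solutions a \<zeta> \<Lambda> \<and>
      qp = (\<lambda>i. monic_with_roots (proots (qp i)))"
    using assms by (auto simp: bethe_solutions_iff nondegenerate_qq_solutions_def)
qed auto

text \<open>For fixed \<open>q_+\<close> the solutions form a coset of the kernels of the operators,
  which are 0 for \<open>\<zeta> i \<noteq> 0\<close> and the multiples of \<open>q i\<close> for
  \<open>\<zeta> i = 0\<close>.\<close>

lemma qq_fiber:
  assumes W: "W \<in> bethe_solutions a \<zeta> \<Lambda>"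
    and S: "\<And>l. l \<in> S \<longleftrightarrow> \<zeta> l = 0"
  shows "\<exists>qm. {s \<in> nondegenerate_qq_solutions a \<zeta> \<Lambda>. fst s = (\<lambda>i. monic_with_roots (W i))} =
    {(\<lambda>i. monic_with_roots (W i),
      \<lambda>i. if i \<in> S then qm i + smult (c i) (monic_with_roots (W i)) else qm i) | c. True}"
proof -
  define q where "q = (\<lambda>i. monic_with_roots (W i))"
  have nd: "nondegenerate a \<Lambda> q"
    using W by (simp add: bethe_solutions_iff q_def)
  obtain qm where qm: "\<And>i. qq_operator (\<zeta> i) (q i) (qm i) = qq_rhs a \<Lambda> q i"
    using W by (auto simp: bethe_solutions_iff qq_system_iff q_def)
  define shift where "shift c i = (if i \<in> S then qm i + smult (c i) (q i) else qm i)" for c i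
  have "qq_system a \<zeta> \<Lambda> q r \<longleftrightarrow> (\<exists>c. r = shift c)" for r
  proof
    assume "qq_system a \<zeta> \<Lambda> q r"
    then have ker: "qq_operator (\<zeta> i) (q i) (r i - qm i) = 0" for i
      by (simp add: qq_system_iff qq_operator_diff qm)
    note K = qq_operator_kernel[OF nondegenerate_imp_rsquarefree[OF nd] ker]
    obtain c where c: "\<And>i. r i - qm i = smult (c i) (q i)"
      using K(1) by metis
    \<comment> \<open>Outside \<open>S\<close>, \<open>\<zeta> i \<noteq> 0\<close> forces
      \<open>r i = qm i\<close>, the second branch of \<open>shift\<close>.\<close>
    have "r i = shift c i" for i
      using K(2)[of i] c[of i] by (auto simp: shift_def S algebra_simps)
    then show "\<exists>c. r = shift c" by blast
  next
    assume "\<exists>c. r = shift c"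
    then show "qq_system a \<zeta> \<Lambda> q r"
      by (auto simp: qq_system_iff shift_def S qq_operator_add qq_operator_smult_self simp flip: qm)
  qed
  then have "{s \<in> nondegenerate_qq_solutions a \<zeta> \<Lambda>. fst s = q} = {(q, shift c) | c. True}"
    using nd by (auto simp: nondegenerate_qq_solutions_def)
  then show ?thesis
    unfolding shift_def q_def by blast
qed

text \<open>Each fibre over \<open>W\<close> is now a single pair, which defines
  \<open>\<Phi>\<close>. It is injective because \<open>proots\<close> recovers \<open>W\<close>
  from \<open>q_+\<close>, and surjective by \<open>bethe_roots_ex1\<close>.\<close>

lemma bethe_qq_bijection:
  assumes "\<And>i. \<zeta> i \<noteq> 0"
  shows "\<exists>\<Phi>. bij_betw \<Phi> (bethe_solutions a \<zeta> \<Lambda>) (nondegenerate_qq_solutions a \<zeta> \<Lambda>) \<and>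
    (\<forall>W\<in>bethe_solutions a \<zeta> \<Lambda>. fst (\<Phi> W) = (\<lambda>i. monic_with_roots (W i)))"
proof -
  let ?B = "bethe_solutions a \<zeta> \<Lambda>" and ?Q = "nondegenerate_qq_solutions a \<zeta> \<Lambda>"
  let ?q = "\<lambda>W i. monic_with_roots (W i)"
  have "\<forall>W\<in>?B. \<exists>s. {s \<in> ?Q. fst s = ?q W} = {s}"
  proof
    fix W assume W: "W \<in> ?B"
    \<comment> \<open>With \<open>S = {}\<close> no free constants remain, and the family indexed by
      \<open>c\<close> collapses to one pair.\<close>
    obtain qm where "{s \<in> ?Q. fst s = ?q W} = {(?q W, qm)}"
      using qq_fiber[OF W, of "{}"] assms by auto
    then show "\<exists>s. {s \<in> ?Q. fst s = ?q W} = {s}"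
      by (intro exI[of _ "(?q W, qm)"])
  qed
  from bchoice[OF this] obtain \<Phi>
    where \<Phi>: "\<And>W. W \<in> ?B \<Longrightarrow> {s \<in> ?Q. fst s = ?q W} = {\<Phi> W}"
    by blast
  have fst: "\<Phi> W \<in> ?Q \<and> fst (\<Phi> W) = ?q W" if "W \<in> ?B" for W
    using \<Phi>[OF that] by blast
  have "inj_on \<Phi> ?B"
  proof (rule inj_onI)
    fix V W assume "V \<in> ?B" "W \<in> ?B" "\<Phi> V = \<Phi> W"
    then have "?q V = ?q W" using fst by metis
    then have "proots (?q V i) = proots (?q W i)" for i by (rule fun_cong[THEN arg_cong])
    then show "V = W" by (simp add: fun_eq_iff)
  qed
  moreover have "s \<in> \<Phi> ` ?B" if s: "s \<in> ?Q" for s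
  proof -
    obtain W where W: "W \<in> ?B" "fst s = ?q W"
      using ex1_implies_ex[OF bethe_roots_ex1[of "fst s" "snd s"]] s by auto
    then have "s \<in> {\<Phi> W}"
      using s by (simp flip: \<Phi>)
    then show ?thesis using W by simp
  qed
  ultimately have "bij_betw \<Phi> ?B ?Q"
    using fst by (auto simp: bij_betw_def)
  then show ?thesis using fst by blast
qed

end

section \<open>Regular elements and specialization to a simple Lie algebra\<close>

lemma (in simple_lie_algebra_with_base) regular_semisimple_root_nonzero:
  assumes Z: "Z \<in> h" and reg: "regular_semisimple Z"
  shows "\<alpha> i Z \<noteq> 0"
proof
  assume 0: "\<alpha> i Z = 0"
  obtain e f where e: "e \<in> root_space h (\<alpha> i)" "e \<noteq> 0"
    by (rule coroot_sl2)
  have c: "coroot i \<in> h" "\<alpha> i (coroot i) = 2"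
    using coroot[of i] by (auto simp: is_coroot_def)
  have "e \<in> centralizer Z"
    using e(1) Z 0 by (simp add: root_space_def centralizer_def)
  moreover have "coroot i \<in> centralizer Z"
    using c(1) Z cartan by (simp add: cartan_subalgebra_def centralizer_def)
  \<comment> \<open>The centralizer of \<open>Z\<close> is a Cartan subalgebra, hence commutative;
    yet \<open>e\<close> is an eigenvector of the coroot with eigenvalue 2.\<close>
  ultimately have "br (coroot i) e = 0"
    using reg by (simp add: regular_semisimple_def cartan_subalgebra_def)
  moreover have "br (coroot i) e = scale 2 e"
    using e(1) c by (simp add: root_space_def)
  ultimately show False
    using e(2) by simp
qed

theorem theorem5p11:
  fixes scale :: "complex \<Rightarrow> 'g::ab_group_add \<Rightarrow> 'g"
    and br :: "'g \<Rightarrow> 'g \<Rightarrow> 'g"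
    and h :: "'g set"
    and \<alpha> :: "'i::finite \<Rightarrow> 'g \<Rightarrow> complex"
    and coroot :: "'i \<Rightarrow> 'g"
    and Z :: 'g
    and \<Lambda> :: "'i \<Rightarrow> complex poly"
  assumes "simple_lie_algebra_with_base scale br h \<alpha> coroot"
    and "Z \<in> h"
    and "\<And>i. lead_coeff (\<Lambda> i) = 1"
  shows "let a = cartan_matrix \<alpha> coroot;
             \<zeta> = (\<lambda>i. \<alpha> i Z);
             QQ = nondegenerate_qq_solutions a \<zeta> \<Lambda>;
             BAE = bethe_solutions a \<zeta> \<Lambda>
         in (complex_lie_algebra.regular_semisimple scale br Z \<longrightarrow> (\<forall>i. \<zeta> i \<noteq> 0)) \<and>
            ((\<forall>i. \<zeta> i \<noteq> 0) \<longrightarrow>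
               (\<exists>\<Phi>. bij_betw \<Phi> BAE QQ \<and>
                    (\<forall>W\<in>BAE. fst (\<Phi> W) = (\<lambda>i. monic_with_roots (W i))))) \<and>
            (\<forall>S. (\<forall>l\<in>S. \<zeta> l = 0) \<and> (\<forall>l. l \<notin> S \<longrightarrow> \<zeta> l \<noteq> 0) \<longrightarrow>
               (\<forall>(qp, qm)\<in>QQ. \<exists>!W. W \<in> BAE \<and> qp = (\<lambda>i. monic_with_roots (W i))) \<and>
               (\<forall>W\<in>BAE. \<exists>qm.
                  {s \<in> QQ. fst s = (\<lambda>i. monic_with_roots (W i))} =
                  {(\<lambda>i. monic_with_roots (W i),
                    \<lambda>i. if i \<in> S then qm i + smult (c i) (monic_with_roots (W i)) else qm i)
                   | c. True}))"
proof -
  interpret simple_lie_algebra_with_base scale br h \<alpha> coroot by fact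
  interpret qq_data "cartan_matrix \<alpha> coroot" "\<lambda>i. \<alpha> i Z" \<Lambda>
    by unfold_locales (simp_all add: cartan_matrix_diag cartan_matrix_nonpos)
  have fiber: "\<exists>qm. {s \<in> nondegenerate_qq_solutions (cartan_matrix \<alpha> coroot) (\<lambda>i. \<alpha> i Z) \<Lambda>.
        fst s = (\<lambda>i. monic_with_roots (W i))} =
      {(\<lambda>i. monic_with_roots (W i),
        \<lambda>i. if i \<in> S then qm i + smult (c i) (monic_with_roots (W i)) else qm i) | c. True}"
    if "(\<forall>l\<in>S. \<alpha> l Z = 0) \<and> (\<forall>l. l \<notin> S \<longrightarrow> \<alpha> l Z \<noteq> 0)"
      and "W \<in> bethe_solutions (cartan_matrix \<alpha> coroot) (\<lambda>i. \<alpha> i Z) \<Lambda>" for S W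
    by (rule qq_fiber) (use that in blast)+
  show ?thesis
    unfolding Let_def
  proof (intro conjI impI allI ballI)
    show "\<alpha> i Z \<noteq> 0" if "regular_semisimple Z" for i
      using regular_semisimple_root_nonzero[OF \<open>Z \<in> h\<close> that] .
  next
    assume "\<forall>i. \<alpha> i Z \<noteq> 0"
    then show "\<exists>\<Phi>. bij_betw \<Phi> (bethe_solutions (cartan_matrix \<alpha> coroot) (\<lambda>i. \<alpha> i Z) \<Lambda>)
          (nondegenerate_qq_solutions (cartan_matrix \<alpha> coroot) (\<lambda>i. \<alpha> i Z) \<Lambda>) \<and>
        (\<forall>W\<in>bethe_solutions (cartan_matrix \<alpha> coroot) (\<lambda>i. \<alpha> i Z) \<Lambda>.
          fst (\<Phi> W) = (\<lambda>i. monic_with_roots (W i)))"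
      by (intro bethe_qq_bijection) blast
  next
    fix s assume "s \<in> nondegenerate_qq_solutions (cartan_matrix \<alpha> coroot) (\<lambda>i. \<alpha> i Z) \<Lambda>"
    then show "case s of (qp, qm) \<Rightarrow>
        \<exists>!W. W \<in> bethe_solutions (cartan_matrix \<alpha> coroot) (\<lambda>i. \<alpha> i Z) \<Lambda> \<and>
          qp = (\<lambda>i. monic_with_roots (W i))"
      using bethe_roots_ex1 by (cases s) simp
  qed (rule fiber)
qed

end
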